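(* Let the vectors $\bm{s}_k$, $\tilde{\bm{p}}_k$, $\bm{u}_k$, $\tilde{\bm{u}}_k$ be generated by the transformation algorithm (Bi-CG with the smoothing scheme) described in the context, run without breakdown for the steps $k=0,\dots,m-1$, where $1\le m\le n$. Then the following bi-orthogonal properties hold: $$(\bm{s}_k, A^{\top}\tilde{\bm{p}}_j) = 0 \quad \text{for all } 0\le j<k \text{ with } k\le m,\ k<n,$$ $$(\bm{u}_{k+1}, \tilde{\bm{u}}_{j+1}) = 0 \quad \text{for all } 0\le j<k\le m-1.$$
   Context: $(\bm{x},\bm{y})=\bm{x}^\top\bm{y}$ is the standard inner product on $\mathbb{R}^n$. $A\in\mathbb{R}^{n\times n}$ is nonsymmetric and nonsingular, $\bm{b}\in\mathbb{R}^n$; all computations are in exact arithmetic. Transformation algorithm. Choose $\bm{x}_0\in\mathbb{R}^n$, set $\bm{r}_0=\bm{b}-A\bm{x}_0$, choose $\tilde{\bm{r}}_0\in\mathbb{R}^n$ with $(\tilde{\bm{r}}_0,\bm{r}_0)\ne 0$, and set $\bm{p}_0=\bm{r}_0$, $\tilde{\bm{p}}_0=\tilde{\bm{r}}_0$, $\bm{y}_0=\bm{x}_0$, $\bm{s}_0=\bm{r}_0$, $\tilde{\bm{s}}_0=\tilde{\bm{r}}_0$. Step $k$ ($k=0,1,\dots$) computes in order: - $\alpha_k=\dfrac{(\tilde{\bm{r}}_k,\bm{r}_k)}{(\tilde{\bm{p}}_k,A\bm{p}_k)}$, $\ \bm{x}_{k+1}=\bm{x}_k+\alpha_k\bm{p}_k$,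 - $\bm{r}_{k+1}=\bm{r}_k-\alpha_kA\bm{p}_k$, $\ \tilde{\bm{r}}_{k+1}=\tilde{\bm{r}}_k-\alpha_kA^\top\tilde{\bm{p}}_k$, - $\bm{u}_{k+1}=\bm{r}_{k+1}-\bm{s}_k$, $\ \tilde{\bm{u}}_{k+1}=\tilde{\bm{r}}_{k+1}-\tilde{\bm{s}}_k$, - $\eta_{k+1}=-\dfrac{(\tilde{\bm{s}}_k,\bm{u}_{k+1})+(\bm{s}_k,\tilde{\bm{u}}_{k+1})}{2(\tilde{\bm{u}}_{k+1},\bm{u}_{k+1})}$, - $\bm{y}_{k+1}=\bm{y}_k+\eta_{k+1}(\bm{x}_{k+1}-\bm{y}_k)$, $\ \bm{s}_{k+1}=\bm{s}_k+\eta_{k+1}\bm{u}_{k+1}$, $\ \tilde{\bm{s}}_{k+1}=\tilde{\bm{s}}_k+\eta_{k+1}\tilde{\bm{u}}_{k+1}$, - $\beta_k=\dfrac{(\tilde{\bm{r}}_{k+1},\bm{r}_{k+1})}{(\tilde{\bm{r}}_k,\bm{r}_k)}$, $\ \bm{p}_{k+1}=\bm{r}_{k+1}+\beta_k\bm{p}_k$, $\ \tilde{\bm{p}}_{k+1}=\tilde{\bm{r}}_{k+1}+\beta_k\tilde{\bm{p}}_k$. "Without breakdown for the steps $k=0,\dots,m-1$" means that all denominators are nonzero: $(\tilde{\bm{r}}_k,\bm{r}_k)\ne0$, $(\tilde{\bm{p}}_k,A\bm{p}_k)\ne0$ and $(\tilde{\bm{u}}_{k+1},\bm{u}_{k+1})\ne0$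 for $0\le k\le m-1$. *)

theory Defs
  imports "HOL-Analysis.Analysis"
begin

text \<open>
  The sequences produced by the transformation algorithm (Bi-CG combined with the smoothing
  scheme). A trailing \<open>t\<close> marks the quantities written with a tilde; \<open>'v\<close> is the vector space.
  The entries \<open>u_seq\<close>, \<open>ut_seq\<close> and \<open>eta\<close> are indexed from 1; their values at 0 are
  unconstrained and never used.
\<close>

record 'v bicg_run =
  x_seq :: "nat \<Rightarrow> 'v"
  r_seq :: "nat \<Rightarrow> 'v"
  rt_seq :: "nat \<Rightarrow> 'v"
  p_seq :: "nat \<Rightarrow> 'v"
  pt_seq :: "nat \<Rightarrow> 'v"
  y_seq :: "nat \<Rightarrow> 'v"
  s_seq :: "nat \<Rightarrow> 'v"
  st_seq :: "nat \<Rightarrow> 'v"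
  u_seq :: "nat \<Rightarrow> 'v"
  ut_seq :: "nat \<Rightarrow> 'v"
  alpha :: "nat \<Rightarrow> real"
  beta :: "nat \<Rightarrow> real"
  eta :: "nat \<Rightarrow> real"

text \<open>The vectors \<open>x_seq R 0\<close> and \<open>rt_seq R 0\<close> are the free choices of the algorithm.\<close>

definition bicg_init :: "real^'n^'n \<Rightarrow> real^'n \<Rightarrow> (real^'n) bicg_run \<Rightarrow> bool" where
  "bicg_init A b R \<longleftrightarrow>
     r_seq R 0 = b - A *v x_seq R 0 \<and>
     rt_seq R 0 \<bullet> r_seq R 0 \<noteq> 0 \<and>
     p_seq R 0 = r_seq R 0 \<and>
     pt_seq R 0 = rt_seq R 0 \<and>
     y_seq R 0 = x_seq R 0 \<and>
     s_seq R 0 = r_seq R 0 \<and>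
     st_seq R 0 = rt_seq R 0"

definition bicg_step :: "real^'n^'n \<Rightarrow> (real^'n) bicg_run \<Rightarrow> nat \<Rightarrow> bool" where
  "bicg_step A R k \<longleftrightarrow>
     alpha R k = (rt_seq R k \<bullet> r_seq R k) / (pt_seq R k \<bullet> (A *v p_seq R k)) \<and>
     x_seq R (k + 1) = x_seq R k + alpha R k *\<^sub>R p_seq R k \<and>
     r_seq R (k + 1) = r_seq R k - alpha R k *\<^sub>R (A *v p_seq R k) \<and>
     rt_seq R (k + 1) = rt_seq R k - alpha R k *\<^sub>R (transpose A *v pt_seq R k) \<and>
     u_seq R (k + 1) = r_seq R (k + 1) - s_seq R k \<and>
     ut_seq R (k + 1) = rt_seq R (k + 1) - st_seq R k \<and>
     eta R (k + 1) =
       - ((st_seq R k \<bullet> u_seq R (k + 1) + s_seq R k \<bullet> ut_seq R (k + 1))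
          / (2 * (ut_seq R (k + 1) \<bullet> u_seq R (k + 1)))) \<and>
     y_seq R (k + 1) = y_seq R k + eta R (k + 1) *\<^sub>R (x_seq R (k + 1) - y_seq R k) \<and>
     s_seq R (k + 1) = s_seq R k + eta R (k + 1) *\<^sub>R u_seq R (k + 1) \<and>
     st_seq R (k + 1) = st_seq R k + eta R (k + 1) *\<^sub>R ut_seq R (k + 1) \<and>
     beta R k = (rt_seq R (k + 1) \<bullet> r_seq R (k + 1)) / (rt_seq R k \<bullet> r_seq R k) \<and>
     p_seq R (k + 1) = r_seq R (k + 1) + beta R k *\<^sub>R p_seq R k \<and>
     pt_seq R (k + 1) = rt_seq R (k + 1) + beta R k *\<^sub>R pt_seq R k"

definition no_breakdown_at :: "real^'n^'n \<Rightarrow> (real^'n) bicg_run \<Rightarrow> nat \<Rightarrow> bool" where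
  "no_breakdown_at A R k \<longleftrightarrow>
     rt_seq R k \<bullet> r_seq R k \<noteq> 0 \<and>
     pt_seq R k \<bullet> (A *v p_seq R k) \<noteq> 0 \<and>
     ut_seq R (k + 1) \<bullet> u_seq R (k + 1) \<noteq> 0"

text \<open>
  Only the steps \<open>0, \<dots>, m - 1\<close> are constrained, so entries of \<open>R\<close> beyond those steps are
  arbitrary, and the convention \<open>x / 0 = 0\<close> plays no role.
\<close>

definition bicg_run_without_breakdown ::
    "real^'n^'n \<Rightarrow> real^'n \<Rightarrow> nat \<Rightarrow> (real^'n) bicg_run \<Rightarrow> bool" where
  "bicg_run_without_breakdown A b m R \<longleftrightarrow>
     bicg_init A b R \<and> (\<forall>k<m. bicg_step A R k \<and> no_breakdown_at A R k)"

end

theory Submission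
  imports Defs
begin

text \<open>
  Write \<open>\<rho> k = rt k \<bullet> r k\<close>. The usual Bi-CG induction gives \<open>rt i \<bullet> r j = 0\<close> and
  \<open>pt i \<bullet> A (p j) = 0\<close> for \<open>i \<noteq> j\<close>. The vectors \<open>s k\<close> and \<open>st k\<close> are affine combinations, with equal
  coefficients, of \<open>r 0, \<dots>, r k\<close> and \<open>rt 0, \<dots>, rt k\<close>. Since \<open>\<alpha> j A\<^sup>T (pt j) = rt j - rt (j + 1)\<close>,
  the first claim says that \<open>s k \<bullet> rt j\<close> is the same number \<open>\<tau> k\<close> for all \<open>j \<le> k\<close>; then also
  \<open>s k \<bullet> st i = \<tau> k\<close> for \<open>i \<le> k\<close>, which yields the second claim. Inductively, the smoothing
  parameter equals \<open>\<tau> k / (\<rho> (k + 1) + \<tau> k)\<close>, and this is exactly the value of \<open>\<eta>\<close> for which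
  \<open>(1 - \<eta>) \<tau> k = \<eta> \<rho> (k + 1)\<close>.
\<close>

locale smoothed_bicg =
  fixes A At :: "'a::real_inner \<Rightarrow> 'a" and m :: nat
    and r rt p pt s st :: "nat \<Rightarrow> 'a" and \<alpha> \<beta> \<eta> :: "nat \<Rightarrow> real"
  assumes adjoint: "x \<bullet> A y = At x \<bullet> y"
    and p_0: "p 0 = r 0" and pt_0: "pt 0 = rt 0"
    and s_0: "s 0 = r 0" and st_0: "st 0 = rt 0"
    and r_nonzero: "k < m \<Longrightarrow> rt k \<bullet> r k \<noteq> 0"
    and p_nonzero: "k < m \<Longrightarrow> pt k \<bullet> A (p k) \<noteq> 0"
    and u_nonzero: "k < m \<Longrightarrow> (rt (Suc k) - st k) \<bullet> (r (Suc k) - s k) \<noteq> 0"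
    and \<alpha>_eq: "k < m \<Longrightarrow> \<alpha> k = (rt k \<bullet> r k) / (pt k \<bullet> A (p k))"
    and \<beta>_eq: "k < m \<Longrightarrow> \<beta> k = (rt (Suc k) \<bullet> r (Suc k)) / (rt k \<bullet> r k)"
    and \<eta>_eq: "k < m \<Longrightarrow> \<eta> (Suc k) =
      - ((st k \<bullet> (r (Suc k) - s k) + s k \<bullet> (rt (Suc k) - st k))
         / (2 * ((rt (Suc k) - st k) \<bullet> (r (Suc k) - s k))))"
    and r_Suc: "k < m \<Longrightarrow> r (Suc k) = r k - \<alpha> k *\<^sub>R A (p k)"
    and rt_Suc: "k < m \<Longrightarrow> rt (Suc k) = rt k - \<alpha> k *\<^sub>R At (pt k)"
    and p_Suc: "k < m \<Longrightarrow> p (Suc k) = r (Suc k) + \<beta> k *\<^sub>R p k"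
    and pt_Suc: "k < m \<Longrightarrow> pt (Suc k) = rt (Suc k) + \<beta> k *\<^sub>R pt k"
    and s_Suc: "k < m \<Longrightarrow> s (Suc k) = s k + \<eta> (Suc k) *\<^sub>R (r (Suc k) - s k)"
    and st_Suc: "k < m \<Longrightarrow> st (Suc k) = st k + \<eta> (Suc k) *\<^sub>R (rt (Suc k) - st k)"
begin

text \<open>The scalars do not change when plain and tilde vectors and \<open>A\<close>,
  \<open>At\<close> are exchanged, so each fact about one side transfers to the other.\<close>

lemma dual: "smoothed_bicg At A m rt r pt p st s \<alpha> \<beta> \<eta>"
proof -
  have "x \<bullet> At y = A x \<bullet> y" for x y
    by (metis adjoint inner_commute)
  then show ?thesis
    using p_0 pt_0 s_0 st_0 r_nonzero p_nonzero u_nonzero \<alpha>_eq \<beta>_eq \<eta>_eq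
      r_Suc rt_Suc p_Suc pt_Suc s_Suc st_Suc
    by unfold_locales (simp_all add: inner_commute add.commute)
qed

lemma \<alpha>_nonzero: "k < m \<Longrightarrow> \<alpha> k \<noteq> 0"
  using r_nonzero p_nonzero by (simp add: \<alpha>_eq)

lemma At_pt: "k < m \<Longrightarrow> At (pt k) = (1 / \<alpha> k) *\<^sub>R (rt k - rt (Suc k))"
  using \<alpha>_nonzero[of k] by (simp add: rt_Suc)

definition biorthogonal_upto :: "nat \<Rightarrow> bool" where
  "biorthogonal_upto K \<longleftrightarrow>
     (\<forall>i j. i \<le> K \<longrightarrow> j \<le> K \<longrightarrow> i \<noteq> j \<longrightarrow> rt i \<bullet> r j = 0 \<and> pt i \<bullet> A (p j) = 0)"

text \<open>Only the new right-hand index is treated; the new left-hand index follows by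
  \<open>dual\<close>.\<close>

lemma biorthogonal_step:
  assumes "K < m" "biorthogonal_upto K" "j \<le> K"
  shows "rt j \<bullet> r (Suc K) = 0" "pt j \<bullet> A (p (Suc K)) = 0"
proof -
  have r0: "rt i \<bullet> r (Suc K) = 0" if "i \<le> K" for i
  proof -
    \<comment> \<open>\<open>rt i\<close> differs from \<open>pt i\<close> by a multiple of
      \<open>pt (i - 1)\<close>, which is already \<open>A\<close>-orthogonal to
      \<open>p K\<close>.\<close>
    have "rt i \<bullet> A (p K) = pt i \<bullet> A (p K)"
    proof (cases i)
      case (Suc l)
      then have "pt l \<bullet> A (p K) = 0"
        using assms that by (simp add: biorthogonal_upto_def)
      then show ?thesis
        using Suc assms that by (simp add: pt_Suc inner_left_distrib)
    qed (simp add: pt_0)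
    then have "rt i \<bullet> r (Suc K) = rt i \<bullet> r K - \<alpha> K * (pt i \<bullet> A (p K))"
      using assms(1) by (simp add: r_Suc inner_diff_right)
    also have "\<dots> = 0"
      using assms that p_nonzero[of K]
      by (cases "i = K") (simp_all add: biorthogonal_upto_def \<alpha>_eq)
    finally show ?thesis .
  qed
  from r0 assms(3) show "rt j \<bullet> r (Suc K) = 0" .
  have jm: "j < m"
    using assms by simp
  have "pt j \<bullet> A (p (Suc K)) = At (pt j) \<bullet> r (Suc K) + \<beta> K * (pt j \<bullet> A (p K))"
    using assms(1) by (simp add: adjoint p_Suc inner_right_distrib)
  also have "At (pt j) \<bullet> r (Suc K) = - (rt (Suc j) \<bullet> r (Suc K)) / \<alpha> j"
    using r0[OF assms(3)] by (simp add: At_pt[OF jm] inner_diff_left)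
  \<comment> \<open>For \<open>j = K\<close> the choice of \<open>\<beta> K\<close> makes the terms
    cancel; for \<open>j < K\<close> each of them vanishes.\<close>
  also have "\<dots> + \<beta> K * (pt j \<bullet> A (p K)) = 0"
  proof (cases "j = K")
    case True
    then show ?thesis
      using r_nonzero[OF assms(1)] p_nonzero[OF assms(1)] assms(1)
      by (simp add: \<alpha>_eq \<beta>_eq)
  next
    case False
    then show ?thesis
      using assms r0[of "Suc j"] by (simp add: biorthogonal_upto_def)
  qed
  finally show "pt j \<bullet> A (p (Suc K)) = 0" .
qed

lemma biorthogonal: "K \<le> m \<Longrightarrow> biorthogonal_upto K"
proof (induction K)
  case 0
  then show ?case by (simp add: biorthogonal_upto_def)
next
  case (Suc K)
  interpret d: smoothed_bicg At A m rt r pt p st s \<alpha> \<beta> \<eta>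
    by (rule dual)
  have K: "K < m" "biorthogonal_upto K"
    using Suc by simp_all
  have "d.biorthogonal_upto K"
    using K(2) unfolding biorthogonal_upto_def d.biorthogonal_upto_def
    by (metis adjoint inner_commute)
  note d_step = d.biorthogonal_step[OF K(1) this]
  have "rt (Suc K) \<bullet> r j = 0" "pt (Suc K) \<bullet> A (p j) = 0" if "j \<le> K" for j
    using d_step[OF that] by (metis adjoint inner_commute)+
  then show ?case
    using K(2) biorthogonal_step[OF K] unfolding biorthogonal_upto_def
    by (metis le_SucE)
qed

lemma rt_r_orthogonal: "\<lbrakk>i \<le> m; j \<le> m; i \<noteq> j\<rbrakk> \<Longrightarrow> rt i \<bullet> r j = 0"
  using biorthogonal[of m] by (simp add: biorthogonal_upto_def)

text \<open>\<open>s i\<close> is an affine combination of \<open>r 0, \<dots>, r i\<close>.\<close>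

lemma inner_s_const:
  assumes "i \<le> m" "\<And>j. j \<le> i \<Longrightarrow> v \<bullet> r j = c"
  shows "v \<bullet> s i = c"
  using assms
  by (induction i) (simp_all add: s_0 s_Suc inner_add_right inner_diff_right)

lemma rt_s_orthogonal: "k < j \<Longrightarrow> j \<le> m \<Longrightarrow> rt j \<bullet> s k = 0"
  by (rule inner_s_const) (auto intro: rt_r_orthogonal)

lemma inner_st_const:
  "i \<le> m \<Longrightarrow> (\<And>j. j \<le> i \<Longrightarrow> v \<bullet> rt j = c) \<Longrightarrow> v \<bullet> st i = c"
  by (rule smoothed_bicg.inner_s_const[OF dual])

text \<open>The common value is named \<open>s k \<bullet> st k\<close> because this is the quantity
  that enters the formula for \<open>\<eta>\<close>.\<close>

lemma s_rt_const: "k \<le> m \<Longrightarrow> j \<le> k \<Longrightarrow> s k \<bullet> rt j = s k \<bullet> st k"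
proof (induction k arbitrary: j)
  case 0
  then show ?case by (simp add: st_0)
next
  case (Suc k)
  define \<tau> \<rho> where "\<tau> = s k \<bullet> st k" and "\<rho> = rt (Suc k) \<bullet> r (Suc k)"
  have k: "k < m"
    using Suc.prems by simp
  have s0: "s k \<bullet> rt (Suc k) = 0"
    using rt_s_orthogonal[of k "Suc k"] k by (simp add: inner_commute)
  have st0: "st k \<bullet> r (Suc k) = 0"
    using smoothed_bicg.rt_s_orthogonal[OF dual, of k "Suc k"] k by (simp add: inner_commute)
  have "(rt (Suc k) - st k) \<bullet> (r (Suc k) - s k) = \<rho> + \<tau>"
    using s0 st0 by (simp add: \<tau>_def \<rho>_def inner_diff_left inner_diff_right inner_commute)
  moreover from this have "\<rho> + \<tau> \<noteq> 0"
    using u_nonzero[OF k] by simp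
  moreover have "st k \<bullet> (r (Suc k) - s k) + s k \<bullet> (rt (Suc k) - st k) = - (2 * \<tau>)"
    using s0 st0 by (simp add: \<tau>_def inner_diff_right inner_commute)
  ultimately have \<eta>: "\<eta> (Suc k) = \<tau> / (\<rho> + \<tau>)" "\<rho> + \<tau> \<noteq> 0"
    by (simp_all add: \<eta>_eq[OF k] del: distrib_left_numeral)
  \<comment> \<open>For \<open>i = Suc k\<close> only the \<open>r (Suc k)\<close> part of
    \<open>s (Suc k)\<close> contributes, for \<open>i \<le> k\<close> only the \<open>s k\<close>
    part.\<close>
  have "s (Suc k) \<bullet> rt i = \<eta> (Suc k) * \<rho>" if "i \<le> Suc k" for i
  proof (cases "i = Suc k")
    case True
    then show ?thesis
      using s0 k by (simp add: s_Suc \<rho>_def inner_add_left inner_diff_left inner_commute[of "r (Suc k)"])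
  next
    case False
    then have "r (Suc k) \<bullet> rt i = 0" "s k \<bullet> rt i = \<tau>"
      using that k rt_r_orthogonal[of i "Suc k"] Suc.IH[of i]
      by (simp_all add: inner_commute \<tau>_def)
    then have "s (Suc k) \<bullet> rt i = (1 - \<eta> (Suc k)) * \<tau>"
      using k by (simp add: s_Suc inner_add_left inner_diff_left algebra_simps)
    also have "\<dots> = \<eta> (Suc k) * \<rho>"
      using \<eta> by (simp add: field_simps)
    finally show ?thesis .
  qed
  with inner_st_const[of "Suc k" "s (Suc k)"] Suc.prems show ?case
    by simp
qed

lemma s_st_const: "k \<le> m \<Longrightarrow> i \<le> k \<Longrightarrow> s k \<bullet> st i = s k \<bullet> st k"
  by (rule inner_st_const) (auto intro: s_rt_const)

theorem s_orthogonal_At_pt: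
  assumes "j < k" "k \<le> m"
  shows "s k \<bullet> At (pt j) = 0"
  using assms s_rt_const[of k j] s_rt_const[of k "Suc j"]
  by (simp add: At_pt inner_diff_right)

text \<open>\<open>r (Suc k)\<close> is orthogonal to both tilde vectors, and \<open>s k\<close> has
  the same product with each since \<open>Suc j \<le> k\<close>.\<close>

theorem u_orthogonal:
  assumes "j < k" "k < m"
  shows "(r (Suc k) - s k) \<bullet> (rt (Suc j) - st j) = 0"
proof -
  have "r (Suc k) \<bullet> rt (Suc j) = 0"
    using assms rt_r_orthogonal[of "Suc j" "Suc k"] by (simp add: inner_commute)
  moreover have "r (Suc k) \<bullet> st j = 0"
    using assms smoothed_bicg.rt_s_orthogonal[OF dual, of j "Suc k"] by simp
  ultimately show ?thesis
    using assms s_rt_const[of k "Suc j"] s_st_const[of k j]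
    by (simp add: inner_diff_left inner_diff_right)
qed

end

text \<open>The locale has no \<open>u\<close> vectors, so their definitions are substituted into
  the step equations.\<close>

lemma bicg_run_smoothed_bicg:
  fixes A :: "real^'n^'n"
  assumes "bicg_run_without_breakdown A b m R"
  shows "smoothed_bicg ((*v) A) ((*v) (transpose A)) m (r_seq R) (rt_seq R) (p_seq R) (pt_seq R)
    (s_seq R) (st_seq R) (alpha R) (beta R) (eta R)"
proof -
  have init: "bicg_init A b R"
    using assms by (simp add: bicg_run_without_breakdown_def)
  have steps: "bicg_step A R k" "no_breakdown_at A R k" if "k < m" for k
    using assms that by (auto simp: bicg_run_without_breakdown_def)
  note step = steps(1)[unfolded bicg_step_def Suc_eq_plus1[symmetric]]
    and nonzero = steps(2)[unfolded no_breakdown_at_def Suc_eq_plus1[symmetric]]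
  show ?thesis
  proof
    show "x \<bullet> (A *v y) = (transpose A *v x) \<bullet> y" for x y
      by (metis dot_lmul_matrix transpose_matrix_vector)
  next
    fix k assume "k < m"
    note st = step[OF this] and nz = nonzero[OF this]
    then have u: "u_seq R (Suc k) = r_seq R (Suc k) - s_seq R k"
      "ut_seq R (Suc k) = rt_seq R (Suc k) - st_seq R k"
      by blast+
    show "(rt_seq R (Suc k) - st_seq R k) \<bullet> (r_seq R (Suc k) - s_seq R k) \<noteq> 0"
      using nz unfolding u by blast
    show "eta R (Suc k) = - ((st_seq R k \<bullet> (r_seq R (Suc k) - s_seq R k)
        + s_seq R k \<bullet> (rt_seq R (Suc k) - st_seq R k))
        / (2 * ((rt_seq R (Suc k) - st_seq R k) \<bullet> (r_seq R (Suc k) - s_seq R k))))"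
      using st unfolding u by blast
    show "s_seq R (Suc k) = s_seq R k + eta R (Suc k) *\<^sub>R (r_seq R (Suc k) - s_seq R k)"
      "st_seq R (Suc k) = st_seq R k + eta R (Suc k) *\<^sub>R (rt_seq R (Suc k) - st_seq R k)"
      using st unfolding u by blast+
  qed (use init[unfolded bicg_init_def] step nonzero in \<open>blast+\<close>)
qed

theorem theorem1:
  fixes A :: "real^'n^'n" and b :: "real^'n" and m :: nat
    and R :: "(real^'n) bicg_run"
  assumes "transpose A \<noteq> A"
    and "invertible A"
    and "1 \<le> m" and "m \<le> CARD('n)"
    and "bicg_run_without_breakdown A b m R"
  shows "(\<forall>k j. j < k \<and> k \<le> m \<and> k < CARD('n) \<longrightarrow>
            s_seq R k \<bullet> (transpose A *v pt_seq R j) = 0)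
       \<and> (\<forall>k j. j < k \<and> k \<le> m - 1 \<longrightarrow>
            u_seq R (k + 1) \<bullet> ut_seq R (j + 1) = 0)"
proof -
  interpret smoothed_bicg "(*v) A" "(*v) (transpose A)" m "r_seq R" "rt_seq R" "p_seq R" "pt_seq R"
    "s_seq R" "st_seq R" "alpha R" "beta R" "eta R"
    using assms(5) by (rule bicg_run_smoothed_bicg)
  have "u_seq R (k + 1) = r_seq R (Suc k) - s_seq R k"
    "ut_seq R (k + 1) = rt_seq R (Suc k) - st_seq R k" if "k < m" for k
    using assms(5) that by (auto simp: bicg_run_without_breakdown_def bicg_step_def)
  \<comment> \<open>As \<open>1 \<le> m\<close>, the bound \<open>k \<le> m - 1\<close> with
    truncated subtraction means \<open>k < m\<close>.\<close>
  then show ?thesis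
    using s_orthogonal_At_pt u_orthogonal assms(3) by auto
qed

end
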